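(* Let $k$ be a finite field with $q$ elements, let $l \ge 0$ be an integer and let $r \in k$. Then \[ |\mathcal{A}_r^l| = \frac{q^l - (-1)^l}{q+1} \quad \text{and} \quad |\mathcal{C}_r^l| = \frac{q^{l+1} + (-1)^l}{q+1}. \]
   Context: $F_k$ is the free monoid of all finite words with letters in $k$ (identity: the empty word $\varepsilon$). $\pi : F_k \to \mathrm{SL}_2(k)$ is the monoid homomorphism with $\pi(\alpha) = \begin{bmatrix} 0 & 1 \\ -1 & \alpha \end{bmatrix}$ for each letter $\alpha \in k$, so $\pi(\alpha_1\cdots\alpha_l)=\pi(\alpha_1)\cdots\pi(\alpha_l)$ and $\pi(\varepsilon)$ is the identity matrix. Let $\mathbb{P}^1(k)$ be the set of equivalence classes of $k^2\smallsetminus\{0\}$ (column vectors) under scaling by elements of $k^\times$; $\mathrm{SL}_2(k)$ acts on it by left multiplication. For $r\in k$, $\mathcal{A}_r = \left\{w \in F_k : \pi(w)\begin{bmatrix} 0 \\ 1 \end{bmatrix} = \begin{bmatrix} 1 \\ r \end{bmatrix} \text{ in } \mathbb{P}^1(k)\right\}$ and $\mathcal{C}_r = F_k\smallsetminus\mathcal{A}_r$. $F_k^l$ is the set of words of length $l$, $\mathcal{A}_r^l = F_k^l\cap\mathcal{A}_r$ and $\mathcal{C}_r^l = F_k^l\cap\mathcal{C}_r$. *)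

theory Defs
  imports "HOL-Analysis.Analysis"
begin

text \<open>
  The field \<open>k\<close> is a type \<open>'a\<close> of class \<^class>\<open>field\<close>, and the free monoid \<open>F\<^sub>k\<close> is the type
  \<open>'a list\<close> with concatenation and identity \<open>[]\<close>. Matrices are given by rows.
\<close>

definition letter_matrix :: "'a::field \<Rightarrow> 'a^2^2" where
  "letter_matrix \<alpha> = vector [vector [0, 1], vector [- 1, \<alpha>]]"

primrec word_matrix :: "'a::field list \<Rightarrow> 'a^2^2" where
  "word_matrix [] = mat 1"
| "word_matrix (\<alpha> # w) = letter_matrix \<alpha> ** word_matrix w"

lemma word_matrix_append: "word_matrix (u @ v) = word_matrix u ** word_matrix v"
  by (induction u) (simp_all add: matrix_mul_assoc)

definition SL2 :: "('a::field^2^2) set" where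
  "SL2 = {M. det M = 1}"

lemma word_matrix_SL2: "word_matrix w \<in> SL2"
proof (induction w)
  case (Cons \<alpha> w)
  have "det (letter_matrix \<alpha>) = 1"
    by (simp add: letter_matrix_def det_2)
  with Cons show ?case
    by (simp add: SL2_def det_mul)
qed (simp add: SL2_def)

definition proj_rel :: "('a::field^2) rel" where
  "proj_rel = {(u, v). u \<noteq> 0 \<and> v \<noteq> 0 \<and> (\<exists>c. c \<noteq> 0 \<and> v = c *s u)}"

definition proj_line :: "('a::field^2) set set" where
  "proj_line = (UNIV - {0}) // proj_rel"

definition proj_point :: "'a::field^2 \<Rightarrow> ('a^2) set" where
  "proj_point v = proj_rel `` {v}"

text \<open>
  A matrix acts on a point of the projective line, which is a set of vectors, by acting on each of
  its representatives. For matrices in \<open>SL2\<close> the image is again a point: see \<open>proj_act_point\<close>.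
\<close>

definition proj_act :: "'a::field^2^2 \<Rightarrow> ('a^2) set \<Rightarrow> ('a^2) set" where
  "proj_act M X = (\<lambda>v. M *v v) ` X"

lemma equiv_proj_rel: "equiv (UNIV - {0}) proj_rel"
proof (rule equivI)
  show "proj_rel \<subseteq> (UNIV - {0}) \<times> (UNIV - {0::'a^2})"
    by (auto simp: proj_rel_def)
  show "refl_on (UNIV - {0::'a^2}) proj_rel"
    by (auto simp: refl_on_def proj_rel_def intro!: exI[of _ 1])
  show "sym (proj_rel :: ('a^2) rel)"
  proof (rule symI)
    fix u v :: "'a^2"
    assume "(u, v) \<in> proj_rel"
    then obtain c where c: "u \<noteq> 0" "v \<noteq> 0" "c \<noteq> 0" "v = c *s u"
      by (auto simp: proj_rel_def)
    then have "u = inverse c *s v"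
      by simp
    moreover have "inverse c \<noteq> 0"
      using c by simp
    ultimately show "(v, u) \<in> proj_rel"
      using c(1,2) unfolding proj_rel_def by blast
  qed
  show "trans (proj_rel :: ('a^2) rel)"
  proof (rule transI)
    fix u v w :: "'a^2"
    assume "(u, v) \<in> proj_rel" "(v, w) \<in> proj_rel"
    then obtain c d where "u \<noteq> 0" "w \<noteq> 0" "c \<noteq> 0" "d \<noteq> 0" "w = (d * c) *s u"
      by (auto simp: proj_rel_def)
    moreover from this have "d * c \<noteq> 0"
      by simp
    ultimately show "(u, w) \<in> proj_rel"
      unfolding proj_rel_def by blast
  qed
qed

lemma proj_act_point:
  fixes M :: "'a::field^2^2"
  assumes "M \<in> SL2" and "v \<noteq> 0"
  shows "proj_act M (proj_point v) = proj_point (M *v v)"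
    and "proj_point (M *v v) \<in> proj_line"
proof -
  from assms(1) have "invertible M"
    by (simp add: SL2_def invertible_det_nz)
  then obtain N where "N ** M = mat 1"
    by (auto simp: invertible_def)
  then have N: "N *v (M *v u) = u" for u
    by (simp add: matrix_vector_mul_assoc)
  have nz: "M *v u \<noteq> 0" if "u \<noteq> 0" for u
    using N[of u] that by (metis matrix_vector_mult_0_right)
  have scale: "M *v (c *s u) = c *s (M *v u)" for c u
    by (simp add: vector_scalar_commute)
  show "proj_act M (proj_point v) = proj_point (M *v v)"
  proof (rule set_eqI)
    fix x
    have "x \<in> proj_act M (proj_point v) \<longleftrightarrow> (\<exists>c. c \<noteq> 0 \<and> x = M *v (c *s v))"
      using assms(2) by (auto simp: proj_act_def proj_point_def proj_rel_def)
    also have "\<dots> \<longleftrightarrow> x \<in> proj_point (M *v v)"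
      using nz[OF assms(2)] by (auto simp: proj_point_def proj_rel_def scale)
    finally show "x \<in> proj_act M (proj_point v) \<longleftrightarrow> x \<in> proj_point (M *v v)" .
  qed
  show "proj_point (M *v v) \<in> proj_line"
    using nz[OF assms(2)] by (simp add: proj_line_def proj_point_def quotientI)
qed

definition words_A :: "'a::field \<Rightarrow> 'a list set" where
  "words_A r =
     {w. proj_act (word_matrix w) (proj_point (vector [0, 1])) = proj_point (vector [1, r])}"

definition words_C :: "'a::field \<Rightarrow> 'a list set" where
  "words_C r = UNIV - words_A r"

definition words_of_length :: "nat \<Rightarrow> 'a list set" where
  "words_of_length l = {w. length w = l}"

definition words_A_len :: "'a::field \<Rightarrow> nat \<Rightarrow> 'a list set" where
  "words_A_len r l = words_of_length l \<inter> words_A r"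

definition words_C_len :: "'a::field \<Rightarrow> nat \<Rightarrow> 'a list set" where
  "words_C_len r l = words_of_length l \<inter> words_C r"

end

theory Submission
  imports Defs
begin

text \<open>
  Write \<open>(x, y)\<close> for \<open>\<pi>(w)\<close> applied to the column \<open>(0, 1)\<close>. Prepending a letter \<open>\<alpha>\<close> to \<open>w\<close>
  turns it into \<open>(y, \<alpha> y - x)\<close>, which lies on the line of \<open>(1, r)\<close> iff \<open>\<alpha> y - x = r y\<close>. This has
  exactly one solution \<open>\<alpha>\<close> if \<open>y \<noteq> 0\<close>, i.e. if \<open>w\<close> is in \<open>\<C>\<^sub>0\<close>, and none otherwise. Hence
  \<open>|\<A>\<^sub>r\<^sup>l\<^sup>+\<^sup>1| = |\<C>\<^sub>0\<^sup>l| = q\<^sup>l - |\<A>\<^sub>0\<^sup>l|\<close>, and the formula follows by induction on \<open>l\<close>.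
\<close>

definition word_vec :: "'a::field list \<Rightarrow> 'a^2" where
  "word_vec w = word_matrix w *v vector [0, 1]"

lemma word_vec_Nil [simp]: "word_vec [] = vector [0, 1]"
  by (simp add: word_vec_def)

lemma word_vec_Cons [simp]:
  "word_vec (\<alpha> # w) $ 1 = word_vec w $ 2"
  "word_vec (\<alpha> # w) $ 2 = \<alpha> * word_vec w $ 2 - word_vec w $ 1"
proof -
  have "word_vec (\<alpha> # w) = letter_matrix \<alpha> *v word_vec w"
    by (simp add: word_vec_def matrix_vector_mul_assoc)
  then show "word_vec (\<alpha> # w) $ 1 = word_vec w $ 2"
    and "word_vec (\<alpha> # w) $ 2 = \<alpha> * word_vec w $ 2 - word_vec w $ 1"
    by (simp_all add: letter_matrix_def matrix_vector_mult_def sum_2)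
qed

lemma word_vec_nonzero: "word_vec w $ 1 \<noteq> 0 \<or> word_vec w $ 2 \<noteq> 0"
  by (induction w) auto

text \<open>Two nonzero vectors of the plane are proportional iff the determinant with these columns
  vanishes. This trades the unknown scalar for a polynomial equation.\<close>

lemma proj_point_eq_iff:
  fixes u v :: "'a::field^2"
  assumes "u \<noteq> 0" "v \<noteq> 0"
  shows "proj_point u = proj_point v \<longleftrightarrow> u $ 1 * v $ 2 = u $ 2 * v $ 1"
proof -
  have "proj_point u = proj_point v \<longleftrightarrow> (\<exists>c. c \<noteq> 0 \<and> v = c *s u)"
    using eq_equiv_class_iff[OF equiv_proj_rel, of u v] assms
    by (simp add: proj_point_def proj_rel_def)
  also have "\<dots> \<longleftrightarrow> u $ 1 * v $ 2 = u $ 2 * v $ 1"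
  proof
    assume eq: "u $ 1 * v $ 2 = u $ 2 * v $ 1"
    show "\<exists>c. c \<noteq> 0 \<and> v = c *s u"
    proof (cases "u $ 1 = 0")
      case True
      with assms eq have "u $ 2 \<noteq> 0" "v $ 1 = 0" "v $ 2 \<noteq> 0"
        by (auto simp: vec_eq_iff forall_2)
      with True show ?thesis
        by (intro exI[of _ "v $ 2 / u $ 2"]) (auto simp: vec_eq_iff forall_2)
    next
      case False
      with assms eq have "v $ 1 \<noteq> 0"
        by (auto simp: vec_eq_iff forall_2)
      with False eq show ?thesis
        by (intro exI[of _ "v $ 1 / u $ 1"]) (auto simp: vec_eq_iff forall_2 field_simps)
    qed
  qed auto
  finally show ?thesis .
qed

text \<open>The determinant criterion against (1, \<open>r\<close>). For \<open>r\<close> = 0 it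
  reads y = 0, so \<open>words_C 0\<close> consists of the words with y nonzero.\<close>

lemma words_A_iff: "w \<in> words_A r \<longleftrightarrow> word_vec w $ 2 = r * word_vec w $ 1"
proof -
  have nz: "word_vec w \<noteq> 0" "vector [1, r] \<noteq> (0 :: 'a^2)" "vector [0, 1] \<noteq> (0 :: 'a^2)"
    using word_vec_nonzero[of w] by (auto simp: vec_eq_iff forall_2)
  show ?thesis
    using proj_act_point(1)[OF word_matrix_SL2 nz(3), of w] proj_point_eq_iff[OF nz(1,2)]
    by (auto simp: words_A_def word_vec_def mult.commute)
qed

lemma Cons_in_words_A_iff:
  "\<alpha> # w \<in> words_A r \<longleftrightarrow> w \<in> words_C 0 \<and> \<alpha> = r + word_vec w $ 1 / word_vec w $ 2"
  \<comment> \<open>If y = 0, the equation for \<alpha> degenerates to x = 0, which is impossible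
    since x and y do not both vanish.\<close>
  using word_vec_nonzero[of w]
  by (cases "word_vec w $ 2 = 0") (auto simp: words_A_iff words_C_def field_simps)

text \<open>Prepending the unique admissible letter is injective, as the tail recovers
  \<open>w\<close>.\<close>

lemma card_words_A_len_Suc:
  fixes r :: "'a::field"
  shows "card (words_A_len r (Suc l)) = card (words_C_len (0 :: 'a) l)"
proof -
  have "words_A_len r (Suc l) =
          (\<lambda>w. (r + word_vec w $ 1 / word_vec w $ 2) # w) ` words_C_len 0 l"
    by (auto simp: words_A_len_def words_C_len_def words_of_length_def length_Suc_conv
        Cons_in_words_A_iff)
  then show ?thesis
    by (simp add: card_image inj_on_def)
qed

lemma card_words_A_len_plus_C:
  fixes r :: "'a::{field,finite}"
  shows "card (words_A_len r l) + card (words_C_len r l) = CARD('a) ^ l"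
proof -
  have fin: "finite (words_of_length l :: 'a list set)"
    and card: "card (words_of_length l :: 'a list set) = CARD('a) ^ l"
    using finite_lists_length_eq[of "UNIV :: 'a set" l] card_lists_length_eq[of "UNIV :: 'a set" l]
    by (simp_all add: words_of_length_def)
  have "words_of_length l = words_A_len r l \<union> words_C_len r l"
    and "words_A_len r l \<inter> words_C_len r l = {}"
    by (auto simp: words_A_len_def words_C_len_def words_C_def)
  with fin card show ?thesis
    by (metis card_Un_disjoint finite_Un)
qed

theorem corollary2p5:
  fixes r :: "'a::{field,finite}" and q l :: nat
  assumes "CARD('a) = q"
  shows "real (card (words_A_len r l)) = (real q ^ l - (- 1) ^ l) / (real q + 1) \<and>
         real (card (words_C_len r l)) = (real q ^ (l + 1) + (- 1) ^ l) / (real q + 1)"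
proof -
  have C: "real (card (words_C_len s n)) = real q ^ n - real (card (words_A_len s n))" for s :: 'a and n
    using card_words_A_len_plus_C[of s n] assms by (metis add_diff_cancel_left' of_nat_add of_nat_power)
  have A: "real (card (words_A_len s n)) = (real q ^ n - (- 1) ^ n) / (real q + 1)" for s :: 'a and n
  \<comment> \<open>The recursion leads from \<open>s\<close> to the parameter 0, so the hypothesis
    is needed at 0 as well.\<close>
  proof (induction n arbitrary: s)
    case 0
    \<comment> \<open>The empty word gives (0, 1), which lies on no line of the form (1,
      \<open>s\<close>).\<close>
    have "words_A_len s 0 = {}"
      by (auto simp: words_A_len_def words_of_length_def words_A_iff)
    then show ?case
      by simp
  next
    case (Suc n)
    show ?case
      by (simp add: card_words_A_len_Suc C Suc.IH field_simps)
  qed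
  then show ?thesis
    by (simp add: C A field_simps)
qed

end
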